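(* Let $N\ge 1$ and $m\ge 3$ be integers. If $\mathfrak P$ is a bounded convex polytope in $\mathbb R^N$ with $m$ facets and $n$ vertices, then \[ n\le \Lambda(N,m):=2\,h_{111}(m-1)\ \vee\ \big(h_{111}(m)+h_{221}(m-1)\big). \]
   Context: Notation: $a\vee b=\max\{a,b\}$, $a\wedge b=\min\{a,b\}$; binomial coefficients $\binom{a}{b}$ are taken to be $0$ when $b<0$ or $b>a$. Define $h_1(m,r):=\binom{m-r}{r}$ and $h_2(m,r):=\binom{m-r}{r-1}$, and \[ r_{11}(m)=\frac{5m-3-\sqrt{5m^2+10m+9}}{10},\qquad r_{21}(m)=\frac{5m+2-\sqrt{5m^2+4}}{10}. \] For $i,j\in\{1,2\}$ set \[ h_{ij1}(m):=h_i\big(m,\lfloor r_{j1}(m)\rfloor\wedge\lfloor N/2\rfloor\big)\ \vee\ h_i\big(m,\lceil r_{j1}(m)\rceil\wedge\lfloor N/2\rfloor\big) \] (so $h_{111}$ uses $h_1$ and $r_{11}$, and $h_{221}$ uses $h_2$ and $r_{21}$). A facet is a face of codimension one. *)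

theory Defs
  imports "HOL-Analysis.Analysis"
begin

definition binom_int :: "int \<Rightarrow> int \<Rightarrow> nat" where
  "binom_int a b = (if 0 \<le> b \<and> b \<le> a then nat a choose nat b else 0)"

definition h1 :: "int \<Rightarrow> int \<Rightarrow> nat" where
  "h1 m r = binom_int (m - r) r"

definition h2 :: "int \<Rightarrow> int \<Rightarrow> nat" where
  "h2 m r = binom_int (m - r) (r - 1)"

definition r11 :: "int \<Rightarrow> real" where
  "r11 m = (5 * m - 3 - sqrt (5 * m^2 + 10 * m + 9)) / 10"

definition r21 :: "int \<Rightarrow> real" where
  "r21 m = (5 * m + 2 - sqrt (5 * m^2 + 4)) / 10"

definition hij1 :: "(int \<Rightarrow> int \<Rightarrow> nat) \<Rightarrow> (int \<Rightarrow> real) \<Rightarrow> nat \<Rightarrow> int \<Rightarrow> nat" where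
  "hij1 h r N m = max (h m (min \<lfloor>r m\<rfloor> (int (N div 2)))) (h m (min \<lceil>r m\<rceil> (int (N div 2))))"

definition h111 :: "nat \<Rightarrow> int \<Rightarrow> nat" where "h111 = hij1 h1 r11"
definition h221 :: "nat \<Rightarrow> int \<Rightarrow> nat" where "h221 = hij1 h2 r21"

definition Lambda :: "nat \<Rightarrow> nat \<Rightarrow> nat" where
  "Lambda N m = max (2 * h111 N (int m - 1)) (h111 N (int m) + h221 N (int m - 1))"

end

theory Submission
  imports Defs "HOL-Library.Function_Algebras" "HOL-Computational_Algebra.Polynomial"
begin

text \<open>
  Fix a linear functional \<open>c\<close> that separates the extreme points of the \<open>d\<close>-dimensional polyhedron
  \<open>P\<close> with \<open>m\<close> facets. The outer normals of the facets through an extreme point \<open>v\<close> span the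
  directions of \<open>P\<close>, so along \<open>P\<close> the functional is a combination of \<open>d\<close> of them. Let \<open>D\<close> and \<open>U\<close>
  be the facets with positive and with negative coefficients: \<open>v\<close> minimises \<open>c\<close> on the intersection
  of \<open>D\<close> and maximises it on the intersection of \<open>U\<close>. Hence, listing extreme points by their value
  of \<open>c\<close>, the sets \<open>D\<close> together with the sets of at most \<open>m - d\<close> facets missing \<open>v\<close> form a skew
  Bollobas system, and likewise the sets \<open>U\<close> for the reverse order. Since \<open>card D + card U \<le> d\<close>,
  every extreme point has \<open>card D \<le> d div 2\<close> or \<open>card U \<le> (d - 1) div 2\<close>, and the skew Bollobas
  theorem bounds the number of points of each kind. The sum of the two bounds is McMullen's upper
  bound, obtained without perturbing to a simple polytope: it is \<open>h1 m k + h2 (m - 1) k\<close> for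
  \<open>d = 2 * k\<close> and \<open>2 * h1 (m - 1) k\<close> for \<open>d = 2 * k + 1\<close>. Both \<open>h1\<close> and \<open>h2\<close> are unimodal in \<open>k\<close>,
  with peaks located by \<open>r11\<close> and \<open>r21\<close>.
\<close>

section \<open>The skew Bollobas theorem\<close>

lemma (in vector_space) card_le_of_separating_subspaces:
  fixes f :: "'i \<Rightarrow> 'o::linorder"
  assumes "finite I" "inj_on f I" "finite T"
    and span: "\<And>i. i \<in> I \<Longrightarrow> g i \<in> span T"
    and subspace: "\<And>i. i \<in> I \<Longrightarrow> subspace (H i)"
    and notin: "\<And>i. i \<in> I \<Longrightarrow> g i \<notin> H i"
    and lower: "\<And>i j. i \<in> I \<Longrightarrow> j \<in> I \<Longrightarrow> f j < f i \<Longrightarrow> g j \<in> H i"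
  shows "card I \<le> card T"
proof -
  have "independent (g ` I) \<and> inj_on g I"
    using assms(1,2) subspace notin lower
  proof (induction I rule: finite_ranking_induct[where f = f])
    case empty
    show ?case by (simp add: independent_empty)
  next
    case (insert i I)
    show ?case
    proof (cases "i \<in> I")
      case True
      with insert show ?thesis by (simp add: insert_absorb)
    next
      case False
      with insert.hyps(2) insert.prems(1) have "f j < f i" if "j \<in> I" for j
        using that by (auto simp: inj_on_def order_less_le)
      with insert.prems have "span (g ` I) \<subseteq> H i"
        by (intro span_minimal) auto
      with insert.prems have "g i \<notin> span (g ` I)" by blast
      moreover from this have "g i \<notin> g ` I" using span_base by blast
      moreover have "independent (g ` I) \<and> inj_on g I"
        using insert.prems by (intro insert.IH) (auto simp: inj_on_def)
      ultimately show ?thesis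
        using False by (simp add: independent_insert)
    qed
  qed
  moreover from this have "card (g ` I) \<le> card T"
    using independent_span_bound[OF \<open>finite T\<close>] span by blast
  ultimately show ?thesis by (simp add: card_image)
qed

interpretation fun_space: vector_space "\<lambda>(c::'k::field) (f::'a \<Rightarrow> 'k) x. c * f x"
  by unfold_locales (auto simp: fun_eq_iff algebra_simps)

lemma subspace_vanishing_at: "fun_space.subspace {h. h x = 0}"
  by (rule fun_space.subspaceI) auto

lemma sum_fun_apply: "(\<Sum>i\<in>I. f i) x = (\<Sum>i\<in>I. f i x)"
  for f :: "'i \<Rightarrow> 'a \<Rightarrow> 'b::comm_monoid_add"
  by (induction I rule: infinite_finite_induct) auto

definition monomials :: "'i set \<Rightarrow> nat \<Rightarrow> (('i \<Rightarrow> 'k::comm_monoid_mult) \<Rightarrow> 'k) set" where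
  "monomials K q = (\<lambda>M y. \<Prod>k\<in>#M. y k) ` multisets_of_size K q"

lemma finite_monomials: "finite K \<Longrightarrow> finite (monomials K q)"
  by (auto simp: monomials_def)

lemma card_monomials_le: "finite K \<Longrightarrow> card (monomials K q) \<le> (card K + q - 1) choose q"
  unfolding monomials_def card_multisets_of_size[symmetric]
  by (intro card_image_le finite_multisets_of_size)

lemma coordinate_times_span_monomials:
  fixes h :: "('i \<Rightarrow> 'k::field) \<Rightarrow> 'k"
  assumes "h \<in> fun_space.span (monomials K q)" "k \<in> K"
  shows "(\<lambda>y. y k * h y) \<in> fun_space.span (monomials K (Suc q))"
  using assms(1)
proof (induction rule: fun_space.span_induct_alt)
  case base
  then show ?case using fun_space.span_zero by (simp add: zero_fun_def)
next
  case (step c g h)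
  then obtain M where "M \<in> multisets_of_size K q" and g_eq: "g = (\<lambda>y. \<Prod>k\<in>#M. y k)"
    by (auto simp: monomials_def)
  then have "add_mset k M \<in> multisets_of_size K (Suc q)"
    using assms(2) by (auto simp: multisets_of_size_def)
  then have "(\<lambda>y. y k * g y) \<in> fun_space.span (monomials K (Suc q))"
    by (intro fun_space.span_base) (force simp: monomials_def g_eq)
  then have "(\<lambda>y. c * (y k * g y)) + (\<lambda>y. y k * h y) \<in> fun_space.span (monomials K (Suc q))"
    using step.IH by (intro fun_space.span_add fun_space.span_scale)
  then show ?case by (simp add: plus_fun_def algebra_simps)
qed

lemma linear_form_times_span_monomials:
  fixes h :: "('i \<Rightarrow> 'k::field) \<Rightarrow> 'k"
  assumes "h \<in> fun_space.span (monomials K q)"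
  shows "(\<lambda>y. (\<Sum>k\<in>K. y k * w k) * h y) \<in> fun_space.span (monomials K (Suc q))"
proof -
  have "(\<Sum>k\<in>K. (\<lambda>y. w k * (y k * h y))) \<in> fun_space.span (monomials K (Suc q))"
    using assms
    by (intro fun_space.span_sum fun_space.span_scale coordinate_times_span_monomials)
  moreover have "(\<Sum>k\<in>K. (\<lambda>y. w k * (y k * h y))) = (\<lambda>y. (\<Sum>k\<in>K. y k * w k) * h y)"
    by (auto simp: fun_eq_iff sum_fun_apply sum_distrib_left ac_simps)
  ultimately show ?thesis by simp
qed

lemma prod_linear_forms_in_span_monomials:
  fixes w :: "'b \<Rightarrow> 'i \<Rightarrow> 'k::field"
  shows "(\<lambda>y. \<Prod>b\<in>#B. \<Sum>k\<in>K. y k * w b k) \<in> fun_space.span (monomials K (size B))"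
proof (induction B)
  case empty
  then show ?case by (auto simp: monomials_def intro: fun_space.span_base)
next
  case (add b B)
  then show ?case
    using linear_form_times_span_monomials[of _ _ _ "w b"] by simp
qed

lemma poly_eq_sum_atMost:
  fixes x :: "'a::comm_semiring_1"
  assumes "degree p \<le> n"
  shows "poly p x = (\<Sum>k\<le>n. coeff p k * x ^ k)"
  unfolding poly_altdef
  using assms by (intro sum.mono_neutral_left) (auto simp: coeff_eq_0)

lemma prod_mset_poly_prod_linear_eq_0_iff:
  fixes A :: "'k::idom set"
  assumes "finite A"
  shows "(\<Prod>b\<in>#B. poly (\<Prod>a\<in>A. [:- a, 1:]) b) = 0 \<longleftrightarrow> A \<inter> set_mset B \<noteq> {}"
proof -
  have "poly (\<Prod>a\<in>A. [:- a, 1:]) b = 0 \<longleftrightarrow> b \<in> A" for b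
    using assms by (auto simp: poly_prod)
  then show ?thesis by auto
qed

text \<open>
  Polynomial method: the product over \<open>B j\<close> of the values of a polynomial of degree at most \<open>p\<close> is
  a form of degree \<open>q\<close> in its \<open>p + 1\<close> coefficients. At the polynomial with root set \<open>A i\<close> it
  vanishes exactly when \<open>A i\<close> meets \<open>B j\<close>, so these forms are linearly independent.
\<close>

lemma skew_Bollobas_mset_of_field:
  fixes A :: "'i \<Rightarrow> 'k::field set" and B :: "'i \<Rightarrow> 'k multiset" and f :: "'i \<Rightarrow> 'o::linorder"
  assumes "finite I" "inj_on f I"
    and finite_A: "\<And>i. i \<in> I \<Longrightarrow> finite (A i)" and card_A: "\<And>i. i \<in> I \<Longrightarrow> card (A i) \<le> p"
    and size_B: "\<And>i. i \<in> I \<Longrightarrow> size (B i) = q"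
    and disjoint: "\<And>i. i \<in> I \<Longrightarrow> A i \<inter> set_mset (B i) = {}"
    and meet: "\<And>i j. i \<in> I \<Longrightarrow> j \<in> I \<Longrightarrow> f j < f i \<Longrightarrow> A i \<inter> set_mset (B j) \<noteq> {}"
  shows "card I \<le> (p + q) choose p"
proof -
  define vanishing where "vanishing i = (\<Prod>a\<in>A i. [:- a, 1:])" for i
  define form where "form j = (\<lambda>y. \<Prod>b\<in>#B j. \<Sum>k\<le>p. y k * b ^ k)" for j
  have form_eq_0_iff: "form j (coeff (vanishing i)) = 0 \<longleftrightarrow> A i \<inter> set_mset (B j) \<noteq> {}"
    if "i \<in> I" for i j
  proof -
    have "degree (vanishing i) \<le> p"
      using card_A[OF that] by (simp add: vanishing_def degree_prod_eq_sum_degree)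
    then have "form j (coeff (vanishing i)) = (\<Prod>b\<in>#B j. poly (vanishing i) b)"
      by (simp add: form_def poly_eq_sum_atMost)
    then show ?thesis
      using prod_mset_poly_prod_linear_eq_0_iff[OF finite_A[OF that], of "B j"]
      by (simp only: vanishing_def)
  qed
  have "card I \<le> card (monomials {..p} q :: ((nat \<Rightarrow> 'k) \<Rightarrow> 'k) set)"
  proof (rule fun_space.card_le_of_separating_subspaces[where f = f
        and g = form and H = "\<lambda>i. {h. h (coeff (vanishing i)) = 0}"])
    show "form i \<in> fun_space.span (monomials {..p} q)" if "i \<in> I" for i
      unfolding form_def size_B[OF that, symmetric] by (rule prod_linear_forms_in_span_monomials)
    show "fun_space.subspace {h. h (coeff (vanishing i)) = 0}" for i
      by (rule subspace_vanishing_at)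
  qed (use \<open>finite I\<close> \<open>inj_on f I\<close> disjoint meet form_eq_0_iff in \<open>auto simp: finite_monomials\<close>)
  also have "\<dots> \<le> (p + q) choose q"
    using card_monomials_le[of "{..p}" q] by simp
  also have "\<dots> = (p + q) choose p"
    using binomial_symmetric[of p "p + q"] by simp
  finally show ?thesis .
qed

theorem skew_Bollobas:
  fixes A B :: "'i \<Rightarrow> 'g set" and f :: "'i \<Rightarrow> 'o::linorder"
  assumes "finite I" "inj_on f I"
    and finite_A: "\<And>i. i \<in> I \<Longrightarrow> finite (A i)" and card_A: "\<And>i. i \<in> I \<Longrightarrow> card (A i) \<le> p"
    and finite_B: "\<And>i. i \<in> I \<Longrightarrow> finite (B i)" and card_B: "\<And>i. i \<in> I \<Longrightarrow> card (B i) \<le> q"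
    and disjoint: "\<And>i. i \<in> I \<Longrightarrow> A i \<inter> B i = {}"
    and meet: "\<And>i j. i \<in> I \<Longrightarrow> j \<in> I \<Longrightarrow> f j < f i \<Longrightarrow> A i \<inter> B j \<noteq> {}"
  shows "card I \<le> (p + q) choose p"
proof -
  define G where "G = (\<Union>i\<in>I. A i \<union> B i)"
  have "finite G" using assms by (auto simp: G_def)
  then obtain label :: "'g \<Rightarrow> nat" where inj_label: "inj_on label G"
    using finite_imp_inj_to_nat_seg by metis
  \<comment> \<open>\<open>e\<close> avoids \<open>0\<close>, so padding with zeros creates no new intersections.\<close>
  define e where "e x = real (Suc (label x))" for x
  define padded where
    "padded i = image_mset e (mset_set (B i)) + replicate_mset (q - card (B i)) 0" for i
  have Int_padded: "e ` A i \<inter> set_mset (padded j) = e ` (A i \<inter> B j)" if "i \<in> I" "j \<in> I" for i j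
  proof -
    have "inj_on e G" using inj_label by (auto simp: inj_on_def e_def)
    then have "e ` A i \<inter> e ` B j = e ` (A i \<inter> B j)"
      using that by (subst inj_on_image_Int[of e G]) (auto simp: G_def)
    moreover have "0 \<notin> e ` A i" by (auto simp: e_def)
    ultimately show ?thesis using finite_B[OF that(2)] by (auto simp: padded_def)
  qed
  show ?thesis
  proof (rule skew_Bollobas_mset_of_field[where A = "\<lambda>i. e ` A i" and B = padded and f = f])
    show "card (e ` A i) \<le> p" if "i \<in> I" for i
      using finite_A[OF that] card_A[OF that] card_image_le order_trans by blast
    show "size (padded i) = q" if "i \<in> I" for i
      using finite_B[OF that] card_B[OF that] by (simp add: padded_def)
  qed (use \<open>finite I\<close> \<open>inj_on f I\<close> finite_A disjoint meet Int_padded in auto)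
qed

section \<open>Facet normals at an extreme point\<close>

definition directions_from :: "'a::euclidean_space \<Rightarrow> 'a set \<Rightarrow> 'a set" where
  "directions_from v S = {u. v + u \<in> affine hull S}"

lemma directions_from_eq: "directions_from v S = (\<lambda>x. x - v) ` (affine hull S)"
  by (force simp: directions_from_def intro!: image_eqI[of _ _ "v + _"])

lemma subspace_directions_from:
  "v \<in> affine hull S \<Longrightarrow> subspace (directions_from v S)"
  unfolding directions_from_eq by (rule affine_diffs_subspace_subtract[OF affine_affine_hull])

lemma dim_directions_from:
  "v \<in> affine hull S \<Longrightarrow> int (dim (directions_from v S)) = aff_dim S"
  unfolding directions_from_eq
  by (simp add: aff_dim_dim_affine_diffs[OF affine_affine_hull, symmetric])

lemma span_eq_of_orthogonal_imp_0:
  fixes L :: "'a::euclidean_space set"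
  assumes "subspace L" "X \<subseteq> L"
    and "\<And>u. u \<in> L \<Longrightarrow> (\<And>x. x \<in> X \<Longrightarrow> orthogonal x u) \<Longrightarrow> u = 0"
  shows "span X = L"
proof (rule ccontr)
  assume "span X \<noteq> L"
  moreover have "span X \<subseteq> L" "span L = L"
    using assms by (simp_all add: span_minimal span_eq_iff)
  ultimately have "span X \<subset> span L" by blast
  then obtain u where "u \<noteq> 0" "u \<in> span L" "\<And>y. y \<in> span X \<Longrightarrow> orthogonal u y"
    using orthogonal_to_subspace_exists_gen by blast
  then show False
    using assms(3)[of u] \<open>span L = L\<close> by (metis orthogonal_commute span_base)
qed

lemma inner_eq_sum_on_span:
  fixes a :: "'i \<Rightarrow> 'a::euclidean_space"
  obtains J w where "J \<subseteq> S" "finite J" "card J = dim (span (a ` S))"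
    "\<forall>u\<in>span (a ` S). c \<bullet> u = (\<Sum>i\<in>J. w i * (a i \<bullet> u))"
proof -
  obtain B where basis: "B \<subseteq> a ` S" "independent B" "a ` S \<subseteq> span B" "card B = dim (a ` S)"
    by (rule basis_exists)
  have span_B: "span B = span (a ` S)"
    using basis by (metis span_mono span_span subset_antisym)
  from basis(1) obtain J where indices: "J \<subseteq> S" "inj_on a J" "B = a ` J"
    by (metis subset_image_inj)
  have "finite B" using basis(2) by (rule independent_imp_finite)
  then have "finite J" using indices finite_imageD by blast
  obtain x y where "x \<in> span B" and c_eq: "c = x + y"
    and y_orthogonal: "\<And>u. u \<in> span B \<Longrightarrow> orthogonal y u"
    using orthogonal_subspace_decomp_exists by blast
  then obtain r where "x = (\<Sum>b\<in>B. r b *\<^sub>R b)"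
    using span_finite[OF \<open>finite B\<close>] by auto
  then have x_eq: "x = (\<Sum>i\<in>J. r (a i) *\<^sub>R a i)" using indices by (simp add: sum.reindex)
  show thesis
  proof
    show "\<forall>u\<in>span (a ` S). c \<bullet> u = (\<Sum>i\<in>J. r (a i) * (a i \<bullet> u))"
      using y_orthogonal by (simp add: c_eq x_eq span_B inner_add_left inner_sum_left orthogonal_def)
  qed (use indices basis \<open>finite J\<close> in \<open>auto simp: card_image\<close>)
qed

lemma connected_Int_rel_frontier:
  fixes T :: "'a::euclidean_space set"
  assumes "connected S" "S \<subseteq> affine hull T" "S \<inter> T \<noteq> {}" "\<not> S \<subseteq> T"
  shows "S \<inter> rel_frontier T \<noteq> {}"
proof
  assume "S \<inter> rel_frontier T = {}"
  then have Int_rel_interior_eq: "S \<inter> rel_interior T = S \<inter> closure T"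
    using rel_interior_subset_closure[of T] by (auto simp: rel_frontier_def)
  have "openin (top_of_set S) (S \<inter> rel_interior T)"
    by (intro openin_subtopology_Int_subset[OF _ assms(2)] openin_Int openin_rel_interior) auto
  then have "openin (top_of_set S) (S \<inter> closure T)" by (simp only: Int_rel_interior_eq)
  moreover have "closedin (top_of_set S) (S \<inter> closure T)"
    by (simp add: closedin_closed_Int)
  ultimately have "S \<inter> closure T = {} \<or> S \<inter> closure T = S"
    using assms(1) unfolding connected_clopen by blast
  then show False
  proof
    assume "S \<inter> closure T = {}"
    then show False using assms(3) closure_subset[of T] by blast
  next
    assume "S \<inter> closure T = S"
    then show False using Int_rel_interior_eq assms(4) rel_interior_subset[of T] by blast
  qed
qed

definition facets_at :: "'a::euclidean_space set \<Rightarrow> 'a \<Rightarrow> 'a set set" where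
  "facets_at P v = {F. F facet_of P \<and> v \<in> F}"

lemma finite_facets_at: "polyhedron P \<Longrightarrow> finite (facets_at P v)"
  by (rule finite_subset[OF _ finite_polyhedron_facets]) (auto simp: facets_at_def)

lemma Int_Inter_facets_at_extreme_point:
  assumes "polyhedron P" "v extreme_point_of P"
  shows "P \<inter> \<Inter>(facets_at P v) = {v}"
proof (cases "P = {v}")
  case True
  then show ?thesis by (auto simp: facets_at_def)
next
  case False
  have "{v} = \<Inter>{F. F facet_of P \<and> {v} \<subseteq> F}"
    using assms False by (intro face_of_polyhedron) (auto simp: face_of_singleton)
  moreover have "v \<in> P" using assms(2) by (simp add: extreme_point_of_def)
  ultimately show ?thesis by (auto simp: facets_at_def)
qed

definition minimality_witness :: "'a::euclidean_space set \<Rightarrow> 'a \<Rightarrow> 'a \<Rightarrow> 'a set set \<Rightarrow> bool" where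
  "minimality_witness P c v D \<longleftrightarrow>
    D \<subseteq> facets_at P v \<and> (\<forall>x\<in>P. D \<subseteq> facets_at P x \<longrightarrow> c \<bullet> v \<le> c \<bullet> x)"

locale facet_representation =
  fixes P :: "'a::euclidean_space set" and normal :: "'a set \<Rightarrow> 'a" and offset :: "'a set \<Rightarrow> real"
  assumes polyhedron: "polyhedron P"
    and normal_le_offset: "F facet_of P \<Longrightarrow> x \<in> P \<Longrightarrow> normal F \<bullet> x \<le> offset F"
    and facet_eq: "F facet_of P \<Longrightarrow> F = P \<inter> {x. normal F \<bullet> x = offset F}"
    and normal_parallel: "F facet_of P \<Longrightarrow> x \<in> affine hull P \<Longrightarrow> x + normal F \<in> affine hull P"

lemma polyhedron_imp_facet_representation:
  fixes P :: "'a::euclidean_space set"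
  assumes "polyhedron P"
  obtains normal offset where "facet_representation P normal offset"
proof -
  obtain H where "finite H" and P_eq: "P = affine hull P \<inter> \<Inter>H"
    and ex_halfspace: "\<forall>h\<in>H. \<exists>a b. a \<noteq> 0 \<and> h = {x. a \<bullet> x \<le> b} \<and>
        (\<forall>x\<in>affine hull P. x + a \<in> affine hull P)"
    and minimal: "\<And>H'. H' \<subset> H \<Longrightarrow> P \<subset> affine hull P \<inter> \<Inter>H'"
    using assms unfolding polyhedron_Int_affine_parallel_minimal by meson
  from ex_halfspace obtain a b where halfspace: "\<And>h. h \<in> H \<Longrightarrow> a h \<noteq> 0 \<and> h = {x. a h \<bullet> x \<le> b h}"
    and parallel: "\<And>h x. h \<in> H \<Longrightarrow> x \<in> affine hull P \<Longrightarrow> x + a h \<in> affine hull P"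
    by metis
  have inner_le: "a h \<bullet> x \<le> b h" if "h \<in> H" "x \<in> P" for h x
  proof -
    have "x \<in> h" using that by (subst (asm) P_eq) simp
    then show ?thesis using halfspace[OF that(1)] by blast
  qed
  obtain h where facet_eq: "\<And>F. F facet_of P \<Longrightarrow> h F \<in> H \<and> F = P \<inter> {x. a (h F) \<bullet> x = b (h F)}"
    using facet_of_polyhedron_explicit[OF \<open>finite H\<close> P_eq halfspace minimal] by metis
  have "facet_representation P (\<lambda>F. a (h F)) (\<lambda>F. b (h F))"
  proof
    show "a (h F) \<bullet> x \<le> b (h F)" if "F facet_of P" "x \<in> P" for F x
      using facet_eq[OF that(1)] inner_le that(2) by blast
    show "F = P \<inter> {x. a (h F) \<bullet> x = b (h F)}" if "F facet_of P" for F
      using facet_eq[OF that] by blast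
    show "x + a (h F) \<in> affine hull P" if "F facet_of P" "x \<in> affine hull P" for F x
      using facet_eq[OF that(1)] parallel that(2) by blast
  qed (rule assms)
  then show thesis by (rule that)
qed

context facet_representation
begin

lemma normal_eq_offset: "F facet_of P \<Longrightarrow> x \<in> F \<Longrightarrow> normal F \<bullet> x = offset F"
  using facet_eq by blast

lemma mem_of_normal_le_offset:
  assumes "P \<noteq> {}" "y \<in> affine hull P"
    and y_le: "\<And>F. F facet_of P \<Longrightarrow> normal F \<bullet> y \<le> offset F"
  shows "y \<in> P"
proof (rule ccontr)
  assume "y \<notin> P"
  obtain x where x_interior: "x \<in> rel_interior P"
    using assms(1) polyhedron polyhedron_imp_convex rel_interior_eq_empty by blast
  then have "x \<in> P" using rel_interior_subset by blast
  have "closed_segment x y \<subseteq> affine hull P"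
    using \<open>x \<in> P\<close> assms(2) by (intro closed_segment_subset) (auto simp: hull_inc affine_imp_convex)
  then have "closed_segment x y \<inter> rel_frontier P \<noteq> {}"
    using \<open>x \<in> P\<close> \<open>y \<notin> P\<close> by (intro connected_Int_rel_frontier) auto
  then obtain t F where t_bounds: "0 \<le> t" "t \<le> 1" and facet: "F facet_of P"
    and mem: "(1 - t) *\<^sub>R x + t *\<^sub>R y \<in> F"
    unfolding rel_frontier_of_polyhedron[OF polyhedron] by (auto simp: in_segment)
  have "t \<noteq> 1" using mem facet facet_of_imp_subset \<open>y \<notin> P\<close> by fastforce
  have "x \<notin> F" using x_interior facet by (auto simp: rel_interior_of_polyhedron[OF polyhedron])
  then have "normal F \<bullet> x < offset F"
    using facet_eq[OF facet] normal_le_offset[OF facet \<open>x \<in> P\<close>] \<open>x \<in> P\<close> by force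
  then have "(1 - t) * (normal F \<bullet> x) < (1 - t) * offset F"
    using t_bounds \<open>t \<noteq> 1\<close> by simp
  moreover have "t * (normal F \<bullet> y) \<le> t * offset F"
    using y_le[OF facet] t_bounds by (simp add: mult_left_mono)
  moreover have "(1 - t) * (normal F \<bullet> x) + t * (normal F \<bullet> y) = offset F"
    using normal_eq_offset[OF facet mem] by (simp add: inner_add_right)
  ultimately show False by (simp add: algebra_simps)
qed

lemma eventually_at_right_normal_le_offset:
  assumes facet: "F facet_of P" and "v \<in> P"
    and tight: "v \<in> F \<Longrightarrow> normal F \<bullet> u \<le> 0"
  shows "\<forall>\<^sub>F e in at_right 0. normal F \<bullet> (v + e *\<^sub>R u) \<le> offset F"
proof (cases "v \<in> F")
  case True
  then have "normal F \<bullet> (v + e *\<^sub>R u) \<le> offset F" if "0 < e" for e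
    using that tight normal_eq_offset[OF facet] by (simp add: inner_add_right mult_nonneg_nonpos)
  with eventually_at_right_less show ?thesis by (rule eventually_mono)
next
  case False
  then have "normal F \<bullet> v < offset F"
    using normal_le_offset[OF facet \<open>v \<in> P\<close>] facet_eq[OF facet] \<open>v \<in> P\<close> by force
  moreover have "((\<lambda>e. normal F \<bullet> (v + e *\<^sub>R u)) \<longlongrightarrow> normal F \<bullet> (v + 0 *\<^sub>R u)) (at_right 0)"
    by (intro tendsto_intros)
  ultimately have "\<forall>\<^sub>F e in at_right 0. normal F \<bullet> (v + e *\<^sub>R u) < offset F"
    by (intro order_tendstoD) auto
  then show ?thesis by (rule eventually_mono) simp
qed

lemma feasible_direction:
  assumes "v \<in> P" "u \<in> directions_from v P"
    and "\<And>F. F \<in> facets_at P v \<Longrightarrow> normal F \<bullet> u \<le> 0"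
  obtains e where "0 < e" "v + e *\<^sub>R u \<in> P"
proof -
  have "\<forall>\<^sub>F e in at_right 0. normal F \<bullet> (v + e *\<^sub>R u) \<le> offset F" if "F facet_of P" for F
    using assms that by (intro eventually_at_right_normal_le_offset) (auto simp: facets_at_def)
  then have "\<forall>\<^sub>F e in at_right 0. \<forall>F\<in>{F. F facet_of P}. normal F \<bullet> (v + e *\<^sub>R u) \<le> offset F"
    using finite_polyhedron_facets[OF polyhedron] by (intro eventually_ball_finite) auto
  with eventually_at_right_less have "\<forall>\<^sub>F e in at_right (0::real). 0 < e \<and>
      (\<forall>F\<in>{F. F facet_of P}. normal F \<bullet> (v + e *\<^sub>R u) \<le> offset F)"
    by (rule eventually_conj)
  then obtain e :: real where "0 < e"
    and satisfied: "\<And>F. F facet_of P \<Longrightarrow> normal F \<bullet> (v + e *\<^sub>R u) \<le> offset F"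
    using eventually_happens' trivial_limit_at_right_real by blast
  have "e *\<^sub>R u \<in> directions_from v P"
    using assms(1,2) by (intro subspace_scale subspace_directions_from) (auto intro: hull_inc)
  with satisfied have "v + e *\<^sub>R u \<in> P"
    using assms(1) by (intro mem_of_normal_le_offset) (auto simp: directions_from_def)
  with \<open>0 < e\<close> show thesis by (rule that)
qed

lemma direction_orthogonal_to_normals_eq_0:
  assumes "v extreme_point_of P" "u \<in> directions_from v P"
    and orthogonal: "\<And>F. F \<in> facets_at P v \<Longrightarrow> normal F \<bullet> u = 0"
  shows "u = 0"
proof -
  have "v \<in> P" using assms(1) by (simp add: extreme_point_of_def)
  then obtain e where "0 < e" and moved: "v + e *\<^sub>R u \<in> P"
    using feasible_direction assms(2) orthogonal by (metis order_refl)
  have "v + e *\<^sub>R u \<in> F" if "F \<in> facets_at P v" for F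
  proof -
    have "normal F \<bullet> (v + e *\<^sub>R u) = offset F"
      using that orthogonal[OF that] normal_eq_offset by (simp add: facets_at_def inner_add_right)
    then show ?thesis using that moved facet_eq by (auto simp: facets_at_def)
  qed
  with moved have "v + e *\<^sub>R u = v"
    using Int_Inter_facets_at_extreme_point[OF polyhedron assms(1)] by blast
  with \<open>0 < e\<close> show ?thesis by simp
qed

lemma span_normals_at_extreme_point:
  assumes "v extreme_point_of P"
  shows "span (normal ` facets_at P v) = directions_from v P"
proof (rule span_eq_of_orthogonal_imp_0)
  have v_hull: "v \<in> affine hull P" using assms by (simp add: extreme_point_of_def hull_inc)
  show "subspace (directions_from v P)" using v_hull by (rule subspace_directions_from)
  show "normal ` facets_at P v \<subseteq> directions_from v P"
    using v_hull normal_parallel by (auto simp: facets_at_def directions_from_def)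
  show "u = 0" if "u \<in> directions_from v P"
    and "\<And>y. y \<in> normal ` facets_at P v \<Longrightarrow> orthogonal y u" for u
    using direction_orthogonal_to_normals_eq_0[OF assms that(1)] that(2)
    by (auto simp: orthogonal_def)
qed

lemma extreme_point_normal_representation:
  assumes "v extreme_point_of P"
  obtains J w where "J \<subseteq> facets_at P v" "finite J" "int (card J) = aff_dim P"
    "\<forall>x\<in>P. c \<bullet> (x - v) = (\<Sum>F\<in>J. w F * (normal F \<bullet> (x - v)))"
proof -
  have span: "span (normal ` facets_at P v) = directions_from v P"
    using assms by (rule span_normals_at_extreme_point)
  have "v \<in> affine hull P" using assms by (simp add: extreme_point_of_def hull_inc)
  obtain J w where "J \<subseteq> facets_at P v" "finite J" "card J = dim (span (normal ` facets_at P v))"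
    "\<forall>u\<in>span (normal ` facets_at P v). c \<bullet> u = (\<Sum>F\<in>J. w F * (normal F \<bullet> u))"
    by (rule inner_eq_sum_on_span[of "facets_at P v" normal c])
  then show thesis
    using that[of J w] dim_directions_from[OF \<open>v \<in> affine hull P\<close>]
    by (simp add: span directions_from_def hull_inc)
qed

lemma minimality_witness_of_normal_combination:
  assumes J: "J \<subseteq> facets_at P v"
    and combination: "\<forall>x\<in>P. c \<bullet> (x - v) = (\<Sum>F\<in>J. w F * (normal F \<bullet> (x - v)))"
  shows "minimality_witness P c v {F \<in> J. 0 < w F}"
  unfolding minimality_witness_def
proof (intro conjI ballI impI)
  show "{F \<in> J. 0 < w F} \<subseteq> facets_at P v" using J by blast
  fix x assume "x \<in> P" and x_on: "{F \<in> J. 0 < w F} \<subseteq> facets_at P x"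
  have "0 \<le> w F * (normal F \<bullet> (x - v))" if "F \<in> J" for F
  proof (cases "0 < w F")
    case True
    with that J x_on have "F facet_of P" "v \<in> F" "x \<in> F" by (auto simp: facets_at_def)
    then show ?thesis by (simp add: inner_diff_right normal_eq_offset)
  next
    case False
    moreover have "normal F \<bullet> x \<le> normal F \<bullet> v"
      using that J normal_eq_offset normal_le_offset \<open>x \<in> P\<close> by (force simp: facets_at_def)
    ultimately show ?thesis by (simp add: inner_diff_right mult_nonpos_nonpos)
  qed
  then have "0 \<le> c \<bullet> (x - v)"
    using combination \<open>x \<in> P\<close> by (simp add: sum_nonneg)
  then show "c \<bullet> v \<le> c \<bullet> x" by (simp add: inner_diff_right)
qed

end

lemma extreme_point_minimality_witnesses:
  assumes "polyhedron P" "v extreme_point_of P"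
  obtains D U where "minimality_witness P c v D" "minimality_witness P (- c) v U"
    "int (card D + card U) \<le> aff_dim P"
proof -
  obtain normal offset where "facet_representation P normal offset"
    using assms(1) by (rule polyhedron_imp_facet_representation)
  then interpret facet_representation P normal offset .
  obtain J w where indices: "J \<subseteq> facets_at P v" "finite J" "int (card J) = aff_dim P"
    and combination: "\<forall>x\<in>P. c \<bullet> (x - v) = (\<Sum>F\<in>J. w F * (normal F \<bullet> (x - v)))"
    by (rule extreme_point_normal_representation[OF assms(2), of c])
  define D U where "D = {F \<in> J. 0 < w F}" and "U = {F \<in> J. 0 < - w F}"
  show thesis
  proof
    show "minimality_witness P c v D"
      unfolding D_def using indices(1) combination by (rule minimality_witness_of_normal_combination)
    show "minimality_witness P (- c) v U"
      unfolding U_def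
      by (rule minimality_witness_of_normal_combination[OF indices(1)])
         (use combination in \<open>simp add: sum_negf\<close>)
    have "card D + card U = card (D \<union> U)"
      using indices(2) by (subst card_Un_disjoint) (auto simp: D_def U_def)
    also have "\<dots> \<le> card J"
      using indices(2) by (intro card_mono) (auto simp: D_def U_def)
    finally show "int (card D + card U) \<le> aff_dim P" using indices(3) by linarith
  qed
qed

lemma aff_dim_le_card_facets_at:
  assumes "polyhedron P" "v extreme_point_of P"
  shows "aff_dim P \<le> int (card (facets_at P v))"
proof -
  obtain normal offset where "facet_representation P normal offset"
    using assms(1) by (rule polyhedron_imp_facet_representation)
  then interpret facet_representation P normal offset .
  obtain J where "J \<subseteq> facets_at P v" "int (card J) = aff_dim P"
    using assms(2) by (rule extreme_point_normal_representation)
  then show ?thesis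
    using card_mono[OF finite_facets_at[OF assms(1)] \<open>J \<subseteq> facets_at P v\<close>] by linarith
qed

section \<open>The number of extreme points\<close>

lemma card_facets_avoiding_le:
  assumes "polyhedron P" "v extreme_point_of P"
  shows "int (card ({F. F facet_of P} - facets_at P v)) \<le> int (card {F. F facet_of P}) - aff_dim P"
proof -
  have "facets_at P v \<subseteq> {F. F facet_of P}" by (auto simp: facets_at_def)
  then have "card ({F. F facet_of P} - facets_at P v) + card (facets_at P v) = card {F. F facet_of P}"
    using finite_polyhedron_facets[OF assms(1)] finite_facets_at[OF assms(1)]
    by (simp add: card_Diff_subset card_mono)
  then show ?thesis using aff_dim_le_card_facets_at[OF assms] by linarith
qed

corollary aff_dim_le_card_facets:
  assumes "polyhedron P" "v extreme_point_of P"
  shows "aff_dim P \<le> int (card {F. F facet_of P})"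
  using card_facets_avoiding_le[OF assms] by linarith

lemma exists_inj_on_inner:
  fixes V :: "'a::euclidean_space set"
  assumes "finite V"
  obtains c where "inj_on (\<lambda>v. c \<bullet> v) V"
proof -
  define N where "N = (\<Union>v\<in>V. \<Union>w\<in>V - {v}. {c. (v - w) \<bullet> c = 0})"
  have "negligible N"
    unfolding N_def using assms by (intro negligible_Union) (auto intro!: negligible_hyperplane)
  then have "N \<noteq> UNIV" using non_negligible_UNIV by metis
  then obtain c where "c \<notin> N" by blast
  then have "inj_on (\<lambda>v. c \<bullet> v) V"
    by (auto simp: N_def inj_on_def inner_diff_left inner_commute[of c])
  then show thesis by (rule that)
qed

lemma card_le_of_minimality_witnesses:
  fixes P :: "'a::euclidean_space set"
  assumes "polyhedron P" "aff_dim P = int d" "inj_on (\<lambda>v. c \<bullet> v) V"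
    and extreme: "\<And>v. v \<in> V \<Longrightarrow> v extreme_point_of P"
    and ex_witness: "\<And>v. v \<in> V \<Longrightarrow> \<exists>D. minimality_witness P c v D \<and> card D \<le> p"
  defines "q \<equiv> card {F. F facet_of P} - d"
  shows "card V \<le> (p + q) choose p"
proof -
  from ex_witness obtain D where witness_D: "\<And>v. v \<in> V \<Longrightarrow> minimality_witness P c v (D v)"
    and card_D: "\<And>v. v \<in> V \<Longrightarrow> card (D v) \<le> p"
    by metis
  define avoiding where "avoiding v = {F. F facet_of P} - facets_at P v" for v
  show ?thesis
  proof (rule skew_Bollobas[where A = D and B = avoiding and f = "\<lambda>v. c \<bullet> v"])
    show "finite V"
      using extreme by (intro finite_subset[OF _ finite_polyhedron_extreme_points[OF assms(1)]]) auto
    show "finite (avoiding v)" for v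
      using finite_polyhedron_facets[OF assms(1)] by (simp add: avoiding_def)
    show "finite (D v)" if "v \<in> V" for v
      using witness_D[OF that] finite_facets_at[OF assms(1)]
      by (auto simp: minimality_witness_def intro: finite_subset)
    show "card (avoiding v) \<le> q" if "v \<in> V" for v
      using card_facets_avoiding_le[OF assms(1) extreme[OF that]] assms(2)
      by (simp add: avoiding_def q_def)
    show "D v \<inter> avoiding v = {}" if "v \<in> V" for v
      using witness_D[OF that] by (auto simp: minimality_witness_def avoiding_def)
    show "D v \<inter> avoiding x \<noteq> {}" if "v \<in> V" "x \<in> V" "c \<bullet> x < c \<bullet> v" for v x
    proof -
      have "x \<in> P" using extreme[OF that(2)] by (simp add: extreme_point_of_def)
      then have "\<not> D v \<subseteq> facets_at P x"
        using witness_D[OF that(1)] that(3) by (auto simp: minimality_witness_def)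
      then show ?thesis
        using witness_D[OF that(1)] by (auto simp: minimality_witness_def avoiding_def facets_at_def)
    qed
  qed (use assms(3) card_D in auto)
qed

text \<open>
  A polyhedron with an extreme point has at least \<open>d\<close> facets, so the subtraction in \<open>q\<close> truncates
  only if there is nothing to count.
\<close>

theorem card_extreme_points_le:
  fixes P :: "'a::euclidean_space set"
  assumes "polyhedron P" "aff_dim P = int d" "d \<le> p + p' + 1"
  defines "q \<equiv> card {F. F facet_of P} - d"
  shows "card {v. v extreme_point_of P} \<le> ((p + q) choose p) + ((p' + q) choose p')"
proof -
  define V where "V = {v. v extreme_point_of P}"
  have "finite V"
    using assms(1) by (simp add: V_def finite_polyhedron_extreme_points)
  then obtain c where inj_c: "inj_on (\<lambda>v. c \<bullet> v) V"
    by (rule exists_inj_on_inner)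
  define witnessed where "witnessed b k = {v \<in> V. \<exists>D. minimality_witness P b v D \<and> card D \<le> k}" for b k
  have card_witnessed: "card (witnessed b k) \<le> (k + q) choose k" if "inj_on (\<lambda>v. b \<bullet> v) V" for b k
    unfolding q_def
    by (rule card_le_of_minimality_witnesses[OF assms(1,2), of b])
       (use that in \<open>auto simp: witnessed_def V_def inj_on_def\<close>)
  have "V \<subseteq> witnessed c p \<union> witnessed (- c) p'"
  proof
    fix v assume "v \<in> V"
    then obtain D U where "minimality_witness P c v D" "minimality_witness P (- c) v U"
      "card D + card U \<le> d"
      using extreme_point_minimality_witnesses[OF assms(1), of v c] assms(2)
      by (auto simp: V_def simp flip: of_nat_add)
    moreover from this(3) have "card D \<le> p \<or> card U \<le> p'" using assms(3) by linarith
    ultimately show "v \<in> witnessed c p \<union> witnessed (- c) p'" using \<open>v \<in> V\<close> by (auto simp: witnessed_def)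
  qed
  then have "card V \<le> card (witnessed c p) + card (witnessed (- c) p')"
    using \<open>finite V\<close> by (intro order_trans[OF card_mono card_Un_le]) (auto simp: witnessed_def)
  also have "\<dots> \<le> ((p + q) choose p) + ((p' + q) choose p')"
    using inj_c by (intro add_mono card_witnessed) (auto simp: inj_on_def)
  finally show ?thesis by (simp add: V_def)
qed

section \<open>Unimodality of the binomial bounds\<close>

lemma unimodal_le_at_clipped_peak:
  fixes h :: "int \<Rightarrow> 'a::preorder"
  assumes up: "\<And>r. r < peak \<Longrightarrow> h r \<le> h (r + 1)"
    and down: "\<And>r. peak \<le> r \<Longrightarrow> h (r + 1) \<le> h r"
    and "k \<le> K"
  shows "h k \<le> h (min peak K)"
proof (cases "k \<le> peak")
  case True
  have "h k \<le> h l" if "k \<le> l" "l \<le> peak" for l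
    using that
  proof (induction l rule: int_ge_induct)
    case (step l)
    then show ?case using order_trans[OF _ up[of l]] by simp
  qed simp
  then show ?thesis using True assms(3) by simp
next
  case False
  then have "peak \<le> k" by simp
  then have "h k \<le> h peak"
  proof (induction k rule: int_ge_induct)
    case (step k)
    then show ?case using order_trans[OF down[of k]] by simp
  qed simp
  then show ?thesis using False assms(3) by simp
qed

lemma h1_of_nat: "k \<le> m \<Longrightarrow> h1 (int m) (int k) = (m - k) choose k"
  by (simp add: h1_def binom_int_def nat_diff_distrib' flip: of_nat_diff)

lemma h1_eq_0: "r < 0 \<or> M < 2 * r \<Longrightarrow> h1 M r = 0"
  by (auto simp: h1_def binom_int_def)

lemma choose_Suc_mult_eq:
  "(n choose Suc s) * (Suc s * Suc n) = (Suc n choose s) * ((Suc n - s) * (n - s))"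
proof -
  have "Suc s * (n choose Suc s) = (n choose s) * (n - s)"
    by (metis binomial_absorb_comp binomial_absorption mult.commute)
  moreover have "(Suc n choose s) * (Suc n - s) = Suc n * (n choose s)"
    using binomial_absorb_comp[of "Suc n" s] by (simp add: mult.commute)
  ultimately show ?thesis by (metis (no_types, lifting) mult.assoc mult.commute)
qed

lemma h1_Suc_mult_eq:
  assumes "0 \<le> r" "2 * r < M"
  shows "int (h1 M (r + 1)) * ((r + 1) * (M - r)) = int (h1 M r) * ((M - 2 * r) * (M - 2 * r - 1))"
proof -
  define s n where "s = nat r" and "n = nat (M - r - 1)"
  have r_eq: "r = int s" and M_eq: "M = int (Suc n + s)" and "s \<le> n"
    using assms by (auto simp: s_def n_def)
  have "h1 M (r + 1) = n choose Suc s" "h1 M r = Suc n choose s"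
    using h1_of_nat[of "Suc s" "Suc n + s"] h1_of_nat[of s "Suc n + s"]
    by (simp_all add: r_eq M_eq add.commute)
  moreover have "M - 2 * r = int (Suc n - s)" "M - 2 * r - 1 = int (n - s)" "M - r = int (Suc n)"
    "r + 1 = int (Suc s)"
    using \<open>s \<le> n\<close> by (auto simp: r_eq M_eq)
  ultimately show ?thesis
    using choose_Suc_mult_eq[of n s] by (metis of_nat_mult)
qed

text \<open>
  By \<open>h1_Suc_mult_eq\<close>, \<open>h1\<close> increases from \<open>r\<close> to \<open>r + 1\<close> if the difference of the two sides
  below, a quadratic in \<open>r\<close>, is positive. Its smaller root is \<open>r11 M\<close>, and its larger root exceeds
  every \<open>r\<close> with \<open>2 * r < M\<close>.
\<close>

lemma less_r11_iff:
  assumes "2 * r < M"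
  shows "real_of_int r < r11 M \<longleftrightarrow> (r + 1) * (M - r) < (M - 2 * r) * (M - 2 * r - 1)"
proof -
  define \<Delta> where "\<Delta> = 5 * M^2 + 10 * M + 9"
  define t where "t = 5 * M - 3 - 10 * r"
  have "0 \<le> t" using assms by (simp add: t_def)
  have "real_of_int r < r11 M \<longleftrightarrow> sqrt \<Delta> < sqrt ((real_of_int t)\<^sup>2)"
    using \<open>0 \<le> t\<close> by (auto simp: r11_def t_def \<Delta>_def field_simps)
  also have "\<dots> \<longleftrightarrow> \<Delta> < t^2"
    by (metis of_int_less_iff of_int_power real_sqrt_less_iff)
  also have "\<dots> \<longleftrightarrow> (r + 1) * (M - r) < (M - 2 * r) * (M - 2 * r - 1)"
    by (auto simp: \<Delta>_def t_def power2_eq_square algebra_simps)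
  finally show ?thesis .
qed

lemma r11_le:
  assumes "0 \<le> M"
  shows "r11 M \<le> (3 * M - 5) / 10"
proof -
  have "(2 * real_of_int (M + 1))\<^sup>2 \<le> 5 * M^2 + 10 * M + 9"
    using assms by (simp add: power2_eq_square algebra_simps)
  then have "2 * real_of_int (M + 1) \<le> sqrt (5 * M^2 + 10 * M + 9)"
    by (rule real_le_rsqrt)
  then show ?thesis by (simp add: r11_def)
qed

lemma r11_gt:
  assumes "0 \<le> M"
  shows "- 1 < r11 M"
proof -
  have "5 * real_of_int M^2 + 10 * M + 9 < (5 * M + 7)\<^sup>2"
    using assms by (simp add: power2_eq_square algebra_simps add_pos_nonneg)
  then have "sqrt (5 * real_of_int M^2 + 10 * M + 9) < 5 * M + 7"
    using assms by (intro real_less_lsqrt) auto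
  then show ?thesis by (simp add: r11_def)
qed

lemma h1_le_h1_Suc:
  assumes "0 \<le> M" "real_of_int r < r11 M"
  shows "h1 M r \<le> h1 M (r + 1)"
proof (cases "0 \<le> r")
  case False
  then show ?thesis by (simp add: h1_eq_0)
next
  case True
  have "10 * real_of_int r < 3 * real_of_int M - 5"
    using assms(2) r11_le[OF assms(1)] by simp
  with True have "2 * r < M" by linarith
  with True assms(2)
  have "int (h1 M r) * ((r + 1) * (M - r)) \<le> int (h1 M (r + 1)) * ((r + 1) * (M - r))"
    by (subst h1_Suc_mult_eq) (auto simp: less_r11_iff intro: mult_left_mono)
  moreover have "0 < (r + 1) * (M - r)" using True \<open>2 * r < M\<close> by simp
  ultimately show ?thesis by (metis mult_le_cancel_right_pos of_nat_le_iff)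
qed

lemma h1_Suc_le_h1:
  assumes "0 \<le> M" "r11 M \<le> real_of_int r"
  shows "h1 M (r + 1) \<le> h1 M r"
proof (cases "2 * r < M")
  case False
  then show ?thesis by (simp add: h1_eq_0)
next
  case True
  have "0 \<le> r" using assms(2) r11_gt[OF assms(1)] by linarith
  have "(M - 2 * r) * (M - 2 * r - 1) \<le> (r + 1) * (M - r)"
    using assms(2) less_r11_iff[OF True] by linarith
  then have "int (h1 M (r + 1)) * ((r + 1) * (M - r)) \<le> int (h1 M r) * ((r + 1) * (M - r))"
    using True \<open>0 \<le> r\<close> by (subst h1_Suc_mult_eq) (auto intro: mult_left_mono)
  moreover have "0 < (r + 1) * (M - r)" using True \<open>0 \<le> r\<close> by simp
  ultimately show ?thesis by (metis mult_le_cancel_right_pos of_nat_le_iff)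
qed

lemma h1_le_h1_clipped_ceiling_r11:
  assumes "0 \<le> M" "k \<le> K"
  shows "h1 M k \<le> h1 M (min \<lceil>r11 M\<rceil> K)"
  using assms(2)
  by (intro unimodal_le_at_clipped_peak)
     (use assms(1) h1_le_h1_Suc h1_Suc_le_h1 in \<open>auto simp: less_ceiling_iff ceiling_le_iff\<close>)

lemma h1_le_h111: "0 \<le> M \<Longrightarrow> k \<le> N div 2 \<Longrightarrow> h1 M (int k) \<le> h111 N M"
  unfolding h111_def hij1_def
  by (intro max.coboundedI2 h1_le_h1_clipped_ceiling_r11) auto

lemma h2_eq_h1: "h2 M r = h1 (M - 1) (r - 1)"
  by (simp add: h1_def h2_def)

lemma r21_eq_r11: "r21 M = r11 (M - 1) + 1"
  by (simp add: r11_def r21_def power2_eq_square field_simps)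

lemma h2_le_h221:
  assumes "1 \<le> M" "k \<le> N div 2"
  shows "h2 M (int k) \<le> h221 N M"
proof -
  have "h2 M (int k) \<le> h1 (M - 1) (min \<lceil>r11 (M - 1)\<rceil> (int (N div 2) - 1))"
    unfolding h2_eq_h1 using assms by (intro h1_le_h1_clipped_ceiling_r11) auto
  also have "\<dots> = h2 M (min \<lceil>r21 M\<rceil> (int (N div 2)))"
    by (simp add: h2_eq_h1 r21_eq_r11 min_diff_distrib_left)
  finally show ?thesis by (simp add: h221_def hij1_def)
qed

section \<open>The upper bound\<close>

lemma card_extreme_points_le_even:
  fixes P :: "'a::euclidean_space set"
  assumes "polyhedron P" "aff_dim P = int (2 * k)" "1 \<le> k" "card {F. F facet_of P} = m"
  shows "card {v. v extreme_point_of P} \<le> h1 (int m) (int k) + h2 (int m - 1) (int k)"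
proof (cases "\<exists>v. v extreme_point_of P")
  case True
  then have "2 * k \<le> m"
    using aff_dim_le_card_facets[OF assms(1)] assms(2,4) by force
  then have "h1 (int m) (int k) = (k + (m - 2 * k)) choose k"
    by (simp add: h1_of_nat)
  moreover have "h2 (int m - 1) (int k) = (k - 1 + (m - 2 * k)) choose (k - 1)"
    using \<open>2 * k \<le> m\<close> \<open>1 \<le> k\<close> h1_of_nat[of "k - 1" "m - 2"]
    by (simp add: h2_eq_h1 of_nat_diff)
  moreover have "card {v. v extreme_point_of P}
      \<le> (k + (m - 2 * k) choose k) + (k - 1 + (m - 2 * k) choose (k - 1))"
    using card_extreme_points_le[OF assms(1,2), of k "k - 1"] assms(3,4) by simp
  ultimately show ?thesis by simp
qed simp

lemma card_extreme_points_le_odd: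
  fixes P :: "'a::euclidean_space set"
  assumes "polyhedron P" "aff_dim P = int (2 * k + 1)" "card {F. F facet_of P} = m"
  shows "card {v. v extreme_point_of P} \<le> 2 * h1 (int m - 1) (int k)"
proof (cases "\<exists>v. v extreme_point_of P")
  case True
  then have "2 * k + 1 \<le> m"
    using aff_dim_le_card_facets[OF assms(1)] assms(2,3) by force
  then have "h1 (int m - 1) (int k) = (k + (m - (2 * k + 1))) choose k"
    using h1_of_nat[of k "m - 1"] by (simp add: of_nat_diff)
  moreover have "card {v. v extreme_point_of P} \<le> 2 * ((k + (m - (2 * k + 1))) choose k)"
    using card_extreme_points_le[OF assms(1,2), of k k] assms(3) by simp
  ultimately show ?thesis by simp
qed simp

lemma card_extreme_points_le_Lambda:
  fixes P :: "'a::euclidean_space set"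
  assumes polyhedron: "polyhedron P" "aff_dim P = int d" "card {F. F facet_of P} = m"
    and "1 \<le> d" "d \<le> N" "2 \<le> m"
  shows "card {v. v extreme_point_of P} \<le> Lambda N m"
proof (cases "even d")
  case True
  then obtain k where d_eq: "d = 2 * k" by blast
  then have "card {v. v extreme_point_of P} \<le> h1 (int m) (int k) + h2 (int m - 1) (int k)"
    using polyhedron \<open>1 \<le> d\<close> by (intro card_extreme_points_le_even) auto
  also have "\<dots> \<le> h111 N (int m) + h221 N (int m - 1)"
    using d_eq \<open>d \<le> N\<close> \<open>2 \<le> m\<close> by (intro add_mono h1_le_h111 h2_le_h221) auto
  finally show ?thesis by (simp add: Lambda_def)
next
  case False
  then obtain k where d_eq: "d = 2 * k + 1" by (elim oddE)
  then have "card {v. v extreme_point_of P} \<le> 2 * h1 (int m - 1) (int k)"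
    using polyhedron by (intro card_extreme_points_le_odd) auto
  also have "\<dots> \<le> 2 * h111 N (int m - 1)"
    using d_eq \<open>d \<le> N\<close> \<open>2 \<le> m\<close> by (intro mult_left_mono h1_le_h111) auto
  finally show ?thesis by (simp add: Lambda_def)
qed

lemma facet_of_imp_one_le_aff_dim:
  assumes "F facet_of P"
  shows "1 \<le> aff_dim P"
proof -
  have "F \<noteq> {}" "aff_dim F = aff_dim P - 1" using assms by (auto simp: facet_of_def)
  then show ?thesis using aff_dim_negative_iff[of F] by linarith
qed

theorem mainTheorem1:
  fixes P :: "(real ^ 'N) set" and m :: nat
  assumes "m \<ge> 3"
    and "polytope P"
    and "card {F. F facet_of P} = m"
  shows "card {v. v extreme_point_of P} \<le> Lambda CARD('N) m"
proof -
  have "{F. F facet_of P} \<noteq> {}" using assms(1,3) by force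
  then have "1 \<le> aff_dim P" using facet_of_imp_one_le_aff_dim by blast
  moreover have "aff_dim P \<le> int CARD('N)" using aff_dim_le_DIM[of P] by simp
  ultimately obtain d where "aff_dim P = int d" "1 \<le> d" "d \<le> CARD('N)"
    using zero_le_imp_eq_int[of "aff_dim P"] by auto
  then show ?thesis
    using assms polytope_imp_polyhedron by (intro card_extreme_points_le_Lambda) auto
qed

end
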